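(* Let $f:\mathbb{R}_+\to\mathbb{R}$ be a non-decreasing convex function. Then for any strictly increasing convex sequence $(u_n)_{n=0}^{\infty}$ of elements of $\mathbb{R}_+$, the sequence $(f(u_n))_{n=0}^{\infty}$ is convex.
   Context: $\mathbb{R}_+=[0,\infty)$. A real sequence $(u_n)_{n=0}^{\infty}$ is convex if $2u_n\le u_{n-1}+u_{n+1}$ for all integers $n\ge 1$. *)

theory Defs
  imports "HOL-Analysis.Analysis"
begin

definition convex_seq :: "(nat \<Rightarrow> real) \<Rightarrow> bool" where
  "convex_seq u \<longleftrightarrow> (\<forall>n\<ge>1. 2 * u n \<le> u (n - 1) + u (n + 1))"

end

theory Submission
  imports Defs
begin

text \<open>
  Convexity of a sequence says that each interior term lies below the midpoint of its two
  neighbours. Monotonicity of \<open>f\<close> carries this bound over to the values of \<open>f\<close>, and convexity of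
  \<open>f\<close> bounds its value at the midpoint by the mean of its values at the neighbours.
\<close>

theorem theorem1p11:
  fixes f :: "real \<Rightarrow> real" and u :: "nat \<Rightarrow> real"
  assumes "mono_on {0..} f"
    and "convex_on {0..} f"
    and "range u \<subseteq> {0..}"
    and "strict_mono u"
    and "convex_seq u"
  shows "convex_seq (\<lambda>n. f (u n))"
  unfolding convex_seq_def
proof (intro allI impI)
  fix n :: nat
  assume "1 \<le> n"
  define a b where "a = u (n - 1)" and "b = u (n + 1)"
  have nonneg: "0 \<le> u k" for k
    using assms(3) by auto
  then have ab: "0 \<le> a" "0 \<le> b"
    by (simp_all add: a_def b_def)
  have "u n \<le> (a + b) / 2"
    using assms(5) \<open>1 \<le> n\<close> by (auto simp: convex_seq_def a_def b_def)
  then have "f (u n) \<le> f ((a + b) / 2)"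
    using nonneg ab by (intro mono_onD[OF assms(1)]) auto
  also have "\<dots> \<le> (f a + f b) / 2"
    using convex_onD[OF assms(2), of "1/2" a b] ab by (simp add: add_divide_distrib)
  finally show "2 * f (u n) \<le> f (u (n - 1)) + f (u (n + 1))"
    by (simp add: a_def b_def)
qed

end
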